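(* Let $\alpha\neq0$ be a simple root of $f(x)=0$ (so $f'(\alpha)\ne0$) with $f''(\alpha)\neq 0$, and let $q\ne0$ be a real number satisfying $$\left|1+\frac{f'(\alpha)}{f''(\alpha)}\frac{1-q}{\alpha}\right|\le 1\quad\left(\Longleftrightarrow\quad 0\le\frac{f'(\alpha)}{f''(\alpha)}\frac{q-1}{\alpha}\le 2\right).$$ Then, for an appropriate initial value $x_0$ (sufficiently close to $\alpha$), the convergence to $\alpha$ of the $q$th power of the binomial expansion of Newton's method (of any truncation order $N\ge1$) is equal to or faster than that of Newton's method.
   Context: $f$ is a real function of a real variable, $C^2$ near $\alpha$. Newton's method is $x_{k+1}=x_k-\frac{f(x_k)}{f'(x_k)}$. For an integer $N\ge1$, the $q$th power of the binomial expansion of Newton's method of truncation order $N$ is the recurrence $$x_{k+1}^q=\sum_{i=0}^{N}\binom{q}{i}x_k^{q-i}\left[-\frac{f(x_k)}{f'(x_k)}\right]^i,\qquad \binom{q}{i}=\frac{q(q-1)\cdots(q-i+1)}{i!}.$$ Real powers occurring are assumed to be defined as real numbers (e.g. positive base), and $x_{k+1}$ is recovered from $x_{k+1}^q$ by the inverse of $x\mapsto x^q$ near $\alpha$. If a method has the form $x_{k+1}=\varphi(x_k)$, its asymptotic error constant at $\alpha$ is $\lim_{x\to\alpha}|\varphi(x)-\alpha|/(x-\alpha)^2$. "The convergence of method A to $\alpha$ is equal to or faster than that of method B" means that both methods converge to $\alpha$ from every initial value sufficiently close to $\alpha$, and the asymptotic error constant of A is at most that of B. *)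

theory Defs
  imports "HOL-Analysis.Analysis"
begin

definition C2_near :: "(real \<Rightarrow> real) \<Rightarrow> real \<Rightarrow> bool" where
  "C2_near f \<alpha> \<longleftrightarrow> (\<exists>U. open U \<and> \<alpha> \<in> U \<and>
     (\<forall>x\<in>U. f differentiable (at x)) \<and>
     (\<forall>x\<in>U. deriv f differentiable (at x)) \<and>
     continuous_on U (deriv (deriv f)))"

text \<open>
  The power \<open>x\<^sup>q\<close> with nonzero real base is a real number if the base is positive, or if the
  base is negative and the exponent is a fraction with odd denominator (in particular, an integer).
  In the second case the sign is given by the parity of the numerator, which does not depend on
  the choice of the fraction with odd denominator.  Note that \<^const>\<open>powr\<close> itself does not have
  these values at negative bases.
\<close>

definition real_power_defined :: "real \<Rightarrow> real \<Rightarrow> bool" where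
  "real_power_defined x q \<longleftrightarrow>
     x > 0 \<or> (x < 0 \<and> (\<exists>m n :: int. odd n \<and> q = of_int m / of_int n))"

definition rpow :: "real \<Rightarrow> real \<Rightarrow> real" where
  "rpow x q =
     (if x < 0 \<and> (\<exists>m n :: int. odd m \<and> odd n \<and> q = of_int m / of_int n)
      then - (\<bar>x\<bar> powr q) else \<bar>x\<bar> powr q)"

lemma rpow_pos: "x > 0 \<Longrightarrow> rpow x q = x powr q"
  by (simp add: rpow_def)

lemma rpow_fraction:
  assumes "x \<noteq> 0" and n: "odd n"
  shows "rpow x (of_int m / real n) = root n x powi m"
proof -
  have n0: "n > 0" using n by (cases n) auto
  have par: "(\<exists>k l :: int. odd k \<and> odd l \<and> of_int m / real n = of_int k / of_int l) \<longleftrightarrow> odd m"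
  proof
    assume "\<exists>k l :: int. odd k \<and> odd l \<and> of_int m / real n = of_int k / of_int l"
    then obtain k l :: int where kl: "odd k" "odd l" "of_int m / real n = of_int k / of_int l"
      by blast
    have "l \<noteq> 0" using kl(2) by auto
    then have "real_of_int (m * l) = real_of_int (k * int n)"
      using kl(3) n0 by (simp add: field_simps)
    then have "m * l = k * int n" by linarith
    then have "odd (m * l)" using kl n by simp
    then show "odd m" by simp
  next
    assume "odd m"
    then show "\<exists>k l :: int. odd k \<and> odd l \<and> of_int m / real n = of_int k / of_int l"
      using n by (intro exI[of _ m] exI[of _ "int n"]) auto
  qed
  have base: "\<bar>x\<bar> powr (of_int m / real n) = root n \<bar>x\<bar> powi m"
  proof -
    have "root n \<bar>x\<bar> = \<bar>x\<bar> powr (1 / real n)"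
      using n0 assms(1) by (simp add: root_powr_inverse)
    then have "root n \<bar>x\<bar> powi m = (\<bar>x\<bar> powr (1 / real n)) powr of_int m"
      using assms(1) by (simp add: powr_real_of_int')
    then show ?thesis by (simp add: powr_powr)
  qed
  show ?thesis
  proof (cases "x < 0")
    case False
    then show ?thesis using base by (simp add: rpow_def)
  next
    case True
    then have "root n \<bar>x\<bar> = - root n x" by (simp add: real_root_minus)
    then show ?thesis using True base par
      by (cases "even m") (auto simp: rpow_def power_int_minus_left)
  qed
qed

lemma rpow_of_int: "x \<noteq> 0 \<Longrightarrow> rpow x (of_int m) = x powi m"
  using rpow_fraction[of x 1 m] by simp

text \<open>
  A method \<open>x\<^bsub>k+1\<^esub> = \<phi> x\<^bsub>k\<^esub>\<close> is given by its iteration function together with the set of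
  points at which the step is meaningful.
\<close>

definition newton_domain :: "(real \<Rightarrow> real) \<Rightarrow> real set" where
  "newton_domain f = {x. f differentiable (at x) \<and> deriv f x \<noteq> 0}"

definition newton_map :: "(real \<Rightarrow> real) \<Rightarrow> real \<Rightarrow> real" where
  "newton_map f x = x - f x / deriv f x"

definition binomial_newton_power :: "(real \<Rightarrow> real) \<Rightarrow> real \<Rightarrow> nat \<Rightarrow> real \<Rightarrow> real" where
  "binomial_newton_power f q N x =
     (\<Sum>i=0..N. (q gchoose i) * rpow x (q - real i) * (- (f x / deriv f x)) ^ i)"

text \<open>
  For \<open>q \<noteq> 0\<close> the map \<open>y \<mapsto> y\<^sup>q\<close>, where defined, is injective on the open half-line containing
  \<open>\<alpha>\<close>, so its inverse on that half-line extends the local inverse near \<open>\<alpha>\<close>.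
\<close>

definition same_sign :: "real \<Rightarrow> real set" where
  "same_sign \<alpha> = {y. sgn y = sgn \<alpha>}"

definition binomial_newton_domain :: "(real \<Rightarrow> real) \<Rightarrow> real \<Rightarrow> nat \<Rightarrow> real \<Rightarrow> real set" where
  "binomial_newton_domain f q N \<alpha> =
     {x \<in> newton_domain f. real_power_defined x q \<and>
        binomial_newton_power f q N x \<in> (\<lambda>y. rpow y q) ` same_sign \<alpha>}"

definition binomial_newton_map :: "(real \<Rightarrow> real) \<Rightarrow> real \<Rightarrow> nat \<Rightarrow> real \<Rightarrow> real \<Rightarrow> real" where
  "binomial_newton_map f q N \<alpha> x =
     inv_into (same_sign \<alpha>) (\<lambda>y. rpow y q) (binomial_newton_power f q N x)"

definition converges_locally :: "real set \<Rightarrow> (real \<Rightarrow> real) \<Rightarrow> real \<Rightarrow> bool" where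
  "converges_locally D \<phi> \<alpha> \<longleftrightarrow>
     (\<forall>\<^sub>F x0 in nhds \<alpha>. (\<forall>k. (\<phi> ^^ k) x0 \<in> D) \<and> (\<lambda>k. (\<phi> ^^ k) x0) \<longlonglongrightarrow> \<alpha>)"

definition has_asymptotic_error_constant :: "(real \<Rightarrow> real) \<Rightarrow> real \<Rightarrow> real \<Rightarrow> bool" where
  "has_asymptotic_error_constant \<phi> \<alpha> C \<longleftrightarrow>
     ((\<lambda>x. \<bar>\<phi> x - \<alpha>\<bar> / (x - \<alpha>)\<^sup>2) \<longlongrightarrow> C) (at \<alpha>)"

definition equal_or_faster ::
    "real set \<Rightarrow> (real \<Rightarrow> real) \<Rightarrow> real set \<Rightarrow> (real \<Rightarrow> real) \<Rightarrow> real \<Rightarrow> bool" where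
  "equal_or_faster DA \<phi>A DB \<phi>B \<alpha> \<longleftrightarrow>
     converges_locally DA \<phi>A \<alpha> \<and> converges_locally DB \<phi>B \<alpha> \<and>
     (\<exists>CA CB. has_asymptotic_error_constant \<phi>A \<alpha> CA \<and>
              has_asymptotic_error_constant \<phi>B \<alpha> CB \<and> CA \<le> CB)"

end

theory Submission
  imports Defs "HOL-Real_Asymp.Real_Asymp"
begin

text \<open>
  Put \<open>h = - f x / f' x\<close>.  Since \<open>x\<^sup>q\<^sup>-\<^sup>i = x\<^sup>q / x\<^sup>i\<close>, the method is
  \<open>\<phi> x = x * S (h / x) powr (1 / q)\<close>, where \<open>S\<close> is the binomial series of exponent \<open>q\<close>
  truncated at order \<open>N\<close>.  As \<open>t \<rightarrow> 0\<close>, \<open>S t powr (1 / q) = 1 + t + c t\<^sup>2 + o(t\<^sup>2)\<close> with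
  \<open>c = (1 - q) / 2\<close> for \<open>N = 1\<close> and \<open>c = 0\<close> for \<open>N \<ge> 2\<close>.  Hence \<open>\<phi> x\<close> differs from the
  Newton step by \<open>c h\<^sup>2 / x + o(h\<^sup>2)\<close>, and the signed error constants are
  \<open>f'' \<alpha> / (2 f' \<alpha>)\<close> for Newton and \<open>f'' \<alpha> / (2 f' \<alpha>) + c / \<alpha>\<close> for \<open>\<phi>\<close>; their ratio is
  \<open>1 + (f' \<alpha> / f'' \<alpha>) (1 - q) / \<alpha>\<close> for \<open>N = 1\<close> and \<open>1\<close> otherwise.
\<close>

section \<open>Real powers on a half-line\<close>

text \<open>For negative \<open>x\<close> the exponent is a fraction \<open>m / n\<close> with
  \<open>n\<close> odd, so \<open>rpow\<close> is an integer power of \<open>root n x\<close>.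
  Subtracting \<open>i\<close> lowers that integer by \<open>n * i\<close>, which divides by
  \<open>x ^ i\<close>.\<close>

lemma rpow_diff_nat:
  assumes "real_power_defined x q"
  shows "rpow x (q - real i) = rpow x q / x ^ i"
proof (cases "x > 0")
  case True
  then show ?thesis by (simp add: rpow_pos powr_diff powr_realpow)
next
  case False
  then obtain k l :: int where x: "x < 0" and l: "odd l" and q: "q = of_int k / of_int l"
    using assms by (auto simp: real_power_defined_def)
  \<comment> \<open>The sign of the denominator moves into the numerator, as \<open>root\<close>
    wants a natural index.\<close>
  define n m where "n = nat \<bar>l\<bar>" and "m = k * sgn l"
  have n: "odd n" using l by (simp add: n_def even_nat_iff)
  then have n0: "n > 0" by (cases n) auto
  have q': "q = of_int m / real n"
    using l by (cases "l > 0") (auto simp: q n_def m_def sgn_if)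
  have qi: "q - real i = of_int (m - int n * int i) / real n"
    using n0 by (simp add: q' field_simps)
  have r0: "root n x \<noteq> 0" using x n0 by simp
  have "rpow x (q - real i) = root n x powi m / (root n x ^ n) ^ i"
    unfolding qi using x n r0 rpow_fraction[of x n "m - int n * int i"]
    by (simp add: power_int_diff power_int_mult)
  also have "root n x ^ n = x" by (rule odd_real_root_pow[OF n])
  also have "root n x powi m = rpow x q" unfolding q' using x n by (simp add: rpow_fraction)
  finally show ?thesis .
qed

lemma rpow_mult_pos:
  assumes "s > 0"
  shows "rpow (x * s) q = rpow x q * s powr q"
proof -
  have "\<bar>x * s\<bar> powr q = \<bar>x\<bar> powr q * s powr q"
    using assms by (simp add: abs_mult powr_mult)
  moreover have "x * s < 0 \<longleftrightarrow> x < 0"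
    using assms mult_less_cancel_right_pos[of s x 0] by simp
  ultimately show ?thesis
    unfolding rpow_def by (simp only: if_distribR minus_mult_left split: if_split) blast
qed

text \<open>On one side of 0 both arguments fall into the same branch of \<open>rpow\<close>, so the
  powers of the absolute values agree, and exponent \<open>1 / q\<close> undoes them. This makes
  \<open>inv_into\<close> in the method a genuine inverse.\<close>

lemma inj_on_rpow:
  assumes "q \<noteq> 0" "\<alpha> \<noteq> 0"
  shows "inj_on (\<lambda>y. rpow y q) (same_sign \<alpha>)"
proof (rule inj_onI)
  fix y z assume yz: "y \<in> same_sign \<alpha>" "z \<in> same_sign \<alpha>" and eq: "rpow y q = rpow z q"
  have s: "sgn y = sgn z" and y0: "y \<noteq> 0" and z0: "z \<noteq> 0"
    using yz assms(2) by (auto simp: same_sign_def sgn_if split: if_splits)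
  then have "y < 0 \<longleftrightarrow> z < 0" by (auto simp: sgn_if split: if_splits)
  then have "\<bar>y\<bar> powr q = \<bar>z\<bar> powr q"
    using eq by (auto simp: rpow_def split: if_splits)
  then have "(\<bar>y\<bar> powr q) powr (1 / q) = (\<bar>z\<bar> powr q) powr (1 / q)" by simp
  then have "\<bar>y\<bar> = \<bar>z\<bar>" using assms(1) y0 z0 by (simp add: powr_powr)
  with s show "y = z" by (metis abs_mult_sgn mult.commute)
qed

text \<open>A remainder extended by its limit composes with any inner function tending to the point,
  even one that attains it.\<close>

lemma isCont_fill_in:
  "(g \<longlongrightarrow> c) (at a) \<Longrightarrow> isCont (\<lambda>x. if x = a then c else g x) a"
  unfolding isCont_def
  by (auto elim!: Lim_transform_eventually simp: eventually_at_filter)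

section \<open>The truncated binomial series and its expansion to second order\<close>

text \<open>The partial sum of the binomial series of \<open>(1 + t) powr q\<close>; the argument
  used later is the relative Newton correction.\<close>

definition truncated_binomial :: "real \<Rightarrow> nat \<Rightarrow> real \<Rightarrow> real" where
  "truncated_binomial q N t = (\<Sum>i\<le>N. (q gchoose i) * t ^ i)"

lemma tendsto_truncated_binomial:
  assumes "(g \<longlongrightarrow> 0) F"
  shows "((\<lambda>x. truncated_binomial q N (g x)) \<longlongrightarrow> 1) F"
proof -
  have "((\<lambda>x. truncated_binomial q N (g x)) \<longlongrightarrow> (\<Sum>i\<le>N. (q gchoose i) * 0 ^ i)) F"
    unfolding truncated_binomial_def by (intro tendsto_intros assms)
  moreover have "(\<Sum>i\<le>N. (q gchoose i) * 0 ^ i) = 1"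
    by (simp add: sum.atMost_shift)
  ultimately show ?thesis by simp
qed

lemma binomial_newton_power_eq:
  assumes "real_power_defined x q"
  shows "binomial_newton_power f q N x =
           rpow x q * truncated_binomial q N ((newton_map f x - x) / x)"
  using assms
  by (simp add: binomial_newton_power_def truncated_binomial_def newton_map_def rpow_diff_nat
      sum_distrib_left power_divide power_mult_distrib atMost_atLeast0 mult_ac flip: divide_minus_left)

text \<open>A positive truncated series has a real root of exponent \<open>1 / q\<close>.
  Multiplying \<open>x\<close> by that positive root stays on the side of \<open>\<alpha>\<close>
  and gives a preimage of the prescribed power; injectivity makes it the one that
  \<open>inv_into\<close> selects.\<close>

lemma
  assumes "q \<noteq> 0" "\<alpha> \<noteq> 0" "sgn x = sgn \<alpha>" "real_power_defined x q"
    and S: "truncated_binomial q N ((newton_map f x - x) / x) > 0"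
  shows binomial_newton_power_in_range:
      "binomial_newton_power f q N x \<in> (\<lambda>y. rpow y q) ` same_sign \<alpha>"
    and binomial_newton_map_eq:
      "binomial_newton_map f q N \<alpha> x =
         x * truncated_binomial q N ((newton_map f x - x) / x) powr (1 / q)"
proof -
  let ?s = "truncated_binomial q N ((newton_map f x - x) / x) powr (1 / q)"
  have s: "?s > 0" using S by simp
  have eq: "binomial_newton_power f q N x = rpow (x * ?s) q"
    using assms by (simp add: binomial_newton_power_eq rpow_mult_pos powr_powr)
  have mem: "x * ?s \<in> same_sign \<alpha>"
    using s assms(3) by (simp add: same_sign_def sgn_mult)
  show "binomial_newton_power f q N x \<in> (\<lambda>y. rpow y q) ` same_sign \<alpha>"
    using eq mem by blast
  show "binomial_newton_map f q N \<alpha> x = x * ?s"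
    unfolding binomial_newton_map_def eq
    using inv_into_f_f[OF inj_on_rpow[OF assms(1,2)] mem] by simp
qed

lemma powr_second_order:
  "((\<lambda>u::real. ((1 + u) powr r - 1 - r * u) / u\<^sup>2) \<longlongrightarrow> r * (r - 1) / 2) (at 0)"
  by real_asymp

text \<open>Insert \<open>u = q * t + t\<^sup>2 * B t\<close> into
  \<open>(1 + u) powr r = 1 + r * u + u\<^sup>2 * E u\<close> with \<open>r = 1 / q\<close>. The
  linear term becomes \<open>t\<close>, and the quadratic coefficient is
  \<open>r * B 0 + q\<^sup>2 * E 0\<close>. Its second part is always \<open>(1 - q) / 2\<close>;
  for \<open>N\<close> at least 2 the first part cancels it, for \<open>N = 1\<close> the first part
  is 0.\<close>

lemma truncated_binomial_powr_second_order:
  assumes q: "q \<noteq> 0" and N: "N \<ge> 1"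
  shows "((\<lambda>t. (truncated_binomial q N t powr (1 / q) - 1 - t) / t\<^sup>2) \<longlongrightarrow>
           (if N = 1 then (1 - q) / 2 else 0)) (at 0)"
proof -
  define r where "r = 1 / q"
  \<comment> \<open>With the limit filled in at 0, the expansion with remainder \<open>E\<close> is
    an identity for every \<open>u\<close>.\<close>
  define E where "E u = (if u = 0 then r * (r - 1) / 2 else ((1 + u) powr r - 1 - r * u) / u\<^sup>2)"
    for u :: real
  have E: "(1 + u) powr r = 1 + r * u + u\<^sup>2 * E u" for u
    by (simp add: E_def)
  have "isCont E 0"
    unfolding E_def by (rule isCont_fill_in[OF powr_second_order])
  define B where "B t = (\<Sum>i\<in>{2..N}. (q gchoose i) * t ^ (i - 2))" for t
  have S: "truncated_binomial q N t = 1 + (q * t + t\<^sup>2 * B t)" for t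
  proof -
    have "{..N} = insert 0 (insert 1 {2..N})" using N by auto
    then have "truncated_binomial q N t = 1 + q * t + (\<Sum>i\<in>{2..N}. (q gchoose i) * t ^ i)"
      by (simp add: truncated_binomial_def)
    also have "(\<Sum>i\<in>{2..N}. (q gchoose i) * t ^ i) = t\<^sup>2 * B t"
      unfolding B_def sum_distrib_left
    proof (intro sum.cong refl)
      fix i assume "i \<in> {2..N}"
      then have "t ^ i = t\<^sup>2 * t ^ (i - 2)" by (metis atLeastAtMost_iff le_add_diff_inverse power_add)
      then show "(q gchoose i) * t ^ i = t\<^sup>2 * ((q gchoose i) * t ^ (i - 2))"
        by (simp only: mult.left_commute)
    qed
    finally show ?thesis by simp
  qed
  have B: "(B \<longlongrightarrow> B 0) (at 0)"
    unfolding B_def by (intro tendsto_intros)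
  \<comment> \<open>At 0 only the summand \<open>i = 2\<close> survives, through
    \<open>0 ^ 0 = 1\<close>; it is present exactly when \<open>N\<close> is at least 2.\<close>
  have B0: "B 0 = (if N = 1 then 0 else q * (q - 1) / 2)"
  proof (cases "N = 1")
    case False
    then have "{2..N} = insert 2 {3..N}" using N by auto
    moreover have "(\<Sum>i\<in>{3..N}. (q gchoose i) * 0 ^ (i - 2)) = 0"
      by (intro sum.neutral) auto
    moreover have "q gchoose 2 = q * (q - 1) / 2"
      by (simp add: gbinomial_prod_rev numeral_2_eq_2 prod.atLeast0_lessThan_Suc)
    ultimately show ?thesis
      using False by (simp add: B_def)
  qed (simp add: B_def)
  have "((\<lambda>t. q * t + t\<^sup>2 * B t) \<longlongrightarrow> q * 0 + 0\<^sup>2 * B 0) (at 0)"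
    by (intro tendsto_intros B)
  then have "((\<lambda>t. E (q * t + t\<^sup>2 * B t)) \<longlongrightarrow> E 0) (at 0)"
    by (intro isCont_tendsto_compose[OF \<open>isCont E 0\<close>]) simp
  then have "((\<lambda>t. r * B t + (q + t * B t)\<^sup>2 * E (q * t + t\<^sup>2 * B t)) \<longlongrightarrow>
               r * B 0 + (q + 0 * B 0)\<^sup>2 * E 0) (at 0)"
    by (intro tendsto_intros B)
  moreover have "r * B 0 + (q + 0 * B 0)\<^sup>2 * E 0 = (if N = 1 then (1 - q) / 2 else 0)"
    using q by (simp add: B0 E_def r_def field_simps power2_eq_square)
  moreover have "\<forall>\<^sub>F t in at 0. r * B t + (q + t * B t)\<^sup>2 * E (q * t + t\<^sup>2 * B t) =
      (truncated_binomial q N t powr (1 / q) - 1 - t) / t\<^sup>2"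
  proof (rule eventually_at_filter[THEN iffD2, OF always_eventually], intro allI impI)
    fix t :: real assume t: "t \<noteq> 0"
    have rq: "r * q = 1" using q by (simp add: r_def)
    have "truncated_binomial q N t powr (1 / q) - 1 - t =
        (r * q) * t - t + t\<^sup>2 * (r * B t + (q + t * B t)\<^sup>2 * E (q * t + t\<^sup>2 * B t))"
      unfolding S r_def[symmetric] E by (simp add: algebra_simps power2_eq_square)
    then show "r * B t + (q + t * B t)\<^sup>2 * E (q * t + t\<^sup>2 * B t) =
      (truncated_binomial q N t powr (1 / q) - 1 - t) / t\<^sup>2"
      using t by (simp add: rq)
  qed
  ultimately show ?thesis by (auto elim: Lim_transform_eventually)
qed

section \<open>Newton's method near a simple root\<close>

lemma eventually_in_newton_domain:
  assumes "C2_near f \<alpha>" "deriv f \<alpha> \<noteq> 0"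
  shows "\<forall>\<^sub>F x in nhds \<alpha>. x \<in> newton_domain f"
proof -
  obtain U where U: "open U" "\<alpha> \<in> U" "\<forall>x\<in>U. f differentiable (at x)"
      "\<forall>x\<in>U. deriv f differentiable (at x)"
    using assms(1) by (auto simp: C2_near_def)
  have "isCont (deriv f) \<alpha>"
    using U differentiable_imp_continuous_within by blast
  then have "(deriv f \<longlongrightarrow> deriv f \<alpha>) (nhds \<alpha>)"
    by (simp add: continuous_at tendsto_at_iff_tendsto_nhds)
  then have "\<forall>\<^sub>F x in nhds \<alpha>. deriv f x \<noteq> 0"
    using assms(2) by (rule tendsto_imp_eventually_ne)
  moreover have "\<forall>\<^sub>F x in nhds \<alpha>. x \<in> U" using U by (simp add: eventually_nhds_in_open)
  ultimately show ?thesis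
    by eventually_elim (use U in \<open>auto simp: newton_domain_def\<close>)
qed

text \<open>The Newton error is \<open>((x - \<alpha>) * deriv f x - f x) / deriv f x\<close>.
  Differentiating the numerator cancels \<open>deriv f x\<close> and leaves
  \<open>(x - \<alpha>) * deriv (deriv f) x\<close>, so one use of l'Hopital's rule against
  \<open>(x - \<alpha>)\<^sup>2\<close> and continuity of the second derivative give the
  limit.\<close>

lemma newton_quadratic_error:
  assumes C2: "C2_near f \<alpha>" and f0: "f \<alpha> = 0" and f'0: "deriv f \<alpha> \<noteq> 0"
  shows "((\<lambda>x. (newton_map f x - \<alpha>) / (x - \<alpha>)\<^sup>2) \<longlongrightarrow>
           deriv (deriv f) \<alpha> / (2 * deriv f \<alpha>)) (at \<alpha>)"
proof -
  obtain U where U: "open U" "\<alpha> \<in> U" "\<forall>x\<in>U. f differentiable (at x)"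
      "\<forall>x\<in>U. deriv f differentiable (at x)" "continuous_on U (deriv (deriv f))"
    using C2 by (auto simp: C2_near_def)
  have inU: "\<forall>\<^sub>F x in at \<alpha>. x \<in> U" using U by (simp add: eventually_at_in_open')
  have D: "(f has_real_derivative deriv f x) (at x)"
      "(deriv f has_real_derivative deriv (deriv f) x) (at x)" if "x \<in> U" for x
    using U that by (auto simp: DERIV_deriv_iff_real_differentiable)
  have cont: "(f \<longlongrightarrow> f \<alpha>) (at \<alpha>)" "(deriv f \<longlongrightarrow> deriv f \<alpha>) (at \<alpha>)"
    using D[OF U(2)] by (auto dest: DERIV_isCont simp: isCont_def)
  have cont2: "(deriv (deriv f) \<longlongrightarrow> deriv (deriv f) \<alpha>) (at \<alpha>)"
    using U by (metis continuous_on_eq_continuous_at isCont_def)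
  have ne: "\<forall>\<^sub>F x in at \<alpha>. x \<noteq> \<alpha>" by (rule eventually_neq_at_within)
  have "((\<lambda>x. ((x - \<alpha>) * deriv f x - f x) / (x - \<alpha>)\<^sup>2) \<longlongrightarrow> deriv (deriv f) \<alpha> / 2) (at \<alpha>)"
  proof (rule lhopital[where f' = "\<lambda>x. (x - \<alpha>) * deriv (deriv f) x" and g' = "\<lambda>x. 2 * (x - \<alpha>)"])
    have "((\<lambda>x. (x - \<alpha>) * deriv f x - f x) \<longlongrightarrow> (\<alpha> - \<alpha>) * deriv f \<alpha> - f \<alpha>) (at \<alpha>)"
      by (intro tendsto_intros cont)
    then show "((\<lambda>x. (x - \<alpha>) * deriv f x - f x) \<longlongrightarrow> 0) (at \<alpha>)" by (simp add: f0)
    have "((\<lambda>x. (x - \<alpha>)\<^sup>2) \<longlongrightarrow> (\<alpha> - \<alpha>)\<^sup>2) (at \<alpha>)" by (intro tendsto_intros)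
    then show "((\<lambda>x. (x - \<alpha>)\<^sup>2) \<longlongrightarrow> 0) (at \<alpha>)" by simp
    show "\<forall>\<^sub>F x in at \<alpha>. (x - \<alpha>)\<^sup>2 \<noteq> 0" using ne by eventually_elim simp
    show "\<forall>\<^sub>F x in at \<alpha>. 2 * (x - \<alpha>) \<noteq> 0" using ne by eventually_elim simp
    show "\<forall>\<^sub>F x in at \<alpha>. ((\<lambda>x. (x - \<alpha>) * deriv f x - f x) has_real_derivative
        (x - \<alpha>) * deriv (deriv f) x) (at x)"
      using inU by eventually_elim (auto intro!: derivative_eq_intros D)
    show "\<forall>\<^sub>F x in at \<alpha>. ((\<lambda>x. (x - \<alpha>)\<^sup>2) has_real_derivative 2 * (x - \<alpha>)) (at x)"
      by (intro always_eventually allI) (auto intro!: derivative_eq_intros)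
    have "((\<lambda>x. deriv (deriv f) x / 2) \<longlongrightarrow> deriv (deriv f) \<alpha> / 2) (at \<alpha>)"
      by (intro tendsto_intros cont2) simp
    then show "((\<lambda>x. (x - \<alpha>) * deriv (deriv f) x / (2 * (x - \<alpha>))) \<longlongrightarrow> deriv (deriv f) \<alpha> / 2) (at \<alpha>)"
      by (rule Lim_transform_eventually) (use ne in eventually_elim, simp del: right_diff_distrib_numeral)
  qed
  then have "((\<lambda>x. ((x - \<alpha>) * deriv f x - f x) / (x - \<alpha>)\<^sup>2 / deriv f x) \<longlongrightarrow>
      deriv (deriv f) \<alpha> / 2 / deriv f \<alpha>) (at \<alpha>)"
    by (rule tendsto_divide[OF _ cont(2) f'0])
  moreover have "\<forall>\<^sub>F x in at \<alpha>. deriv f x \<noteq> 0"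
    using cont(2) f'0 by (rule tendsto_imp_eventually_ne)
  then have "\<forall>\<^sub>F x in at \<alpha>. ((x - \<alpha>) * deriv f x - f x) / (x - \<alpha>)\<^sup>2 / deriv f x =
      (newton_map f x - \<alpha>) / (x - \<alpha>)\<^sup>2"
    using ne by eventually_elim (simp add: newton_map_def field_simps)
  ultimately show ?thesis by (auto elim: Lim_transform_eventually)
qed

section \<open>Local convergence from a quadratic error\<close>

text \<open>A quadratic error is eventually at most half the previous distance. A small ball inside
  \<open>D\<close> is therefore invariant, and the errors are dominated by a geometric
  sequence.\<close>

lemma converges_locally_if_quadratic:
  assumes lim: "((\<lambda>x. (\<phi> x - \<alpha>) / (x - \<alpha>)\<^sup>2) \<longlongrightarrow> C) (at \<alpha>)" and fixpt: "\<phi> \<alpha> = \<alpha>"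
    and D: "\<forall>\<^sub>F x in nhds \<alpha>. x \<in> D"
  shows "converges_locally D \<phi> \<alpha>"
proof -
  have "((\<lambda>x. (\<phi> x - \<alpha>) / (x - \<alpha>)\<^sup>2 * (x - \<alpha>)) \<longlongrightarrow> C * (\<alpha> - \<alpha>)) (at \<alpha>)"
    by (intro tendsto_intros lim)
  then have "\<forall>\<^sub>F x in at \<alpha>. dist ((\<phi> x - \<alpha>) / (x - \<alpha>)\<^sup>2 * (x - \<alpha>)) 0 < 1 / 2"
    by (intro tendstoD) auto
  \<comment> \<open>The limit says nothing about \<open>\<alpha>\<close> itself; there the bound
    comes from \<open>fixpt\<close>.\<close>
  then have "\<forall>\<^sub>F x in nhds \<alpha>. \<bar>\<phi> x - \<alpha>\<bar> \<le> \<bar>x - \<alpha>\<bar> / 2"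
    unfolding eventually_at_filter
  proof eventually_elim
    case (elim x)
    show ?case
    proof (cases "x = \<alpha>")
      case False
      then have "(\<phi> x - \<alpha>) / (x - \<alpha>)\<^sup>2 * (x - \<alpha>) = (\<phi> x - \<alpha>) / (x - \<alpha>)"
        by (simp add: power2_eq_square)
      then show ?thesis
        using elim False by (simp add: divide_less_eq)
    qed (simp add: fixpt)
  qed
  with D have "\<forall>\<^sub>F x in nhds \<alpha>. x \<in> D \<and> \<bar>\<phi> x - \<alpha>\<bar> \<le> \<bar>x - \<alpha>\<bar> / 2"
    by eventually_elim simp
  then obtain d where d: "d > 0"
      "\<And>x. \<bar>x - \<alpha>\<bar> < d \<Longrightarrow> x \<in> D \<and> \<bar>\<phi> x - \<alpha>\<bar> \<le> \<bar>x - \<alpha>\<bar> / 2"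
    unfolding eventually_nhds_metric dist_real_def by blast
  have "(\<forall>k. (\<phi> ^^ k) x \<in> D) \<and> (\<lambda>k. (\<phi> ^^ k) x) \<longlonglongrightarrow> \<alpha>" if x: "\<bar>x - \<alpha>\<bar> < d" for x
  proof -
    define e where "e k = \<bar>(\<phi> ^^ k) x - \<alpha>\<bar>" for k
    \<comment> \<open>The bound \<open>e k < d\<close> is carried along because halving is known
      only inside the ball.\<close>
    have bd: "e k \<le> e 0 * (1 / 2) ^ k \<and> e k < d" for k
    proof (induction k)
      case (Suc k)
      then have "e (Suc k) \<le> e k / 2"
        using d(2)[of "(\<phi> ^^ k) x"] by (simp add: e_def)
      moreover have "e 0 * (1 / 2) ^ Suc k = e 0 * (1 / 2) ^ k / 2" by simp
      moreover have "e k \<ge> 0" by (simp add: e_def)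
      ultimately show ?case using Suc by linarith
    qed (use x in \<open>simp add: e_def\<close>)
    have "(\<lambda>k. (\<phi> ^^ k) x - \<alpha>) \<longlonglongrightarrow> 0"
    proof (rule Lim_null_comparison)
      show "\<forall>\<^sub>F k in sequentially. norm ((\<phi> ^^ k) x - \<alpha>) \<le> e 0 * (1 / 2) ^ k"
        using bd by (simp add: e_def)
      show "(\<lambda>k. e 0 * (1 / 2) ^ k) \<longlonglongrightarrow> 0"
        by (intro tendsto_mult_right_zero LIMSEQ_realpow_zero) auto
    qed
    then show ?thesis using d(2) bd unfolding e_def by (simp add: LIM_zero_iff)
  qed
  then show ?thesis
    unfolding converges_locally_def eventually_nhds_metric dist_real_def using d(1) by blast
qed

lemma has_asymptotic_error_constantI:
  "((\<lambda>x. (\<phi> x - \<alpha>) / (x - \<alpha>)\<^sup>2) \<longlongrightarrow> C) (at \<alpha>) \<Longrightarrow> has_asymptotic_error_constant \<phi> \<alpha> \<bar>C\<bar>"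
  unfolding has_asymptotic_error_constant_def by (drule tendsto_rabs) simp

section \<open>The binomial method near the root\<close>

text \<open>The quotient is the Newton error over \<open>x - \<alpha>\<close>, which tends to 0,
  minus 1. It allows squares of the correction to be measured against
  \<open>(x - \<alpha>)\<^sup>2\<close>.\<close>

lemma newton_correction_tendsto:
  assumes "C2_near f \<alpha>" "f \<alpha> = 0" "deriv f \<alpha> \<noteq> 0"
  shows "((\<lambda>x. (newton_map f x - x) / (x - \<alpha>)) \<longlongrightarrow> -1) (at \<alpha>)"
proof -
  have "((\<lambda>x. (newton_map f x - \<alpha>) / (x - \<alpha>)\<^sup>2 * (x - \<alpha>) - 1) \<longlongrightarrow>
      deriv (deriv f) \<alpha> / (2 * deriv f \<alpha>) * (\<alpha> - \<alpha>) - 1) (at \<alpha>)"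
    by (intro tendsto_intros newton_quadratic_error assms)
  then have "((\<lambda>x. (newton_map f x - \<alpha>) / (x - \<alpha>)\<^sup>2 * (x - \<alpha>) - 1) \<longlongrightarrow> -1) (at \<alpha>)" by simp
  then show ?thesis
  proof (rule Lim_transform_eventually)
    show "\<forall>\<^sub>F x in at \<alpha>. (newton_map f x - \<alpha>) / (x - \<alpha>)\<^sup>2 * (x - \<alpha>) - 1 =
        (newton_map f x - x) / (x - \<alpha>)"
      using eventually_neq_at_within[of \<alpha>]
    proof eventually_elim
      case (elim x)
      then have "(newton_map f x - \<alpha>) / (x - \<alpha>)\<^sup>2 * (x - \<alpha>) = (newton_map f x - \<alpha>) / (x - \<alpha>)"
        by (simp add: power2_eq_square)
      moreover have "(newton_map f x - \<alpha>) / (x - \<alpha>) - 1 = (newton_map f x - x) / (x - \<alpha>)"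
        using elim by (simp add: field_simps)
      ultimately show ?case by simp
    qed
  qed
qed

lemma real_power_defined_same_sign:
  "real_power_defined \<alpha> q \<Longrightarrow> sgn x = sgn \<alpha> \<Longrightarrow> real_power_defined x q"
  by (auto simp: real_power_defined_def sgn_if split: if_splits)

text \<open>The relative correction vanishes at \<open>\<alpha>\<close>, so nearby the truncated
  series is close to 1 and hence positive, and the sign of \<open>x\<close> is that of
  \<open>\<alpha>\<close>. The filter \<open>nhds\<close> includes \<open>\<alpha>\<close>, so the
  closed form also yields the fixed point there.\<close>

lemma eventually_binomial_newton:
  assumes C2: "C2_near f \<alpha>" and "\<alpha> \<noteq> 0" "f \<alpha> = 0" "deriv f \<alpha> \<noteq> 0" "q \<noteq> 0" "real_power_defined \<alpha> q"
  shows "\<forall>\<^sub>F x in nhds \<alpha>. x \<in> binomial_newton_domain f q N \<alpha> \<and>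
           binomial_newton_map f q N \<alpha> x =
             x * truncated_binomial q N ((newton_map f x - x) / x) powr (1 / q)"
proof -
  obtain U where U: "open U" "\<alpha> \<in> U" "\<forall>x\<in>U. f differentiable (at x)"
      "\<forall>x\<in>U. deriv f differentiable (at x)"
    using C2 by (auto simp: C2_near_def)
  have "isCont f \<alpha>" "isCont (deriv f) \<alpha>"
    using U differentiable_imp_continuous_within by blast+
  then have "isCont (\<lambda>x. (newton_map f x - x) / x) \<alpha>"
    unfolding newton_map_def using assms by (intro continuous_intros) auto
  then have "((\<lambda>x. (newton_map f x - x) / x) \<longlongrightarrow> 0) (nhds \<alpha>)"
    using assms tendsto_at_iff_tendsto_nhds[of "\<lambda>x. (newton_map f x - x) / x" \<alpha>]
    by (simp add: isCont_def newton_map_def)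
  then have "((\<lambda>x. truncated_binomial q N ((newton_map f x - x) / x)) \<longlongrightarrow> 1) (nhds \<alpha>)"
    by (rule tendsto_truncated_binomial)
  then have S: "\<forall>\<^sub>F x in nhds \<alpha>. truncated_binomial q N ((newton_map f x - x) / x) > 0"
    by (rule order_tendstoD) simp
  have sg: "\<forall>\<^sub>F x in nhds \<alpha>. sgn x = sgn \<alpha>"
  proof (cases "\<alpha> > 0")
    case True
    have "\<forall>\<^sub>F x in nhds \<alpha>. x \<in> {0<..}" using True by (intro eventually_nhds_in_open) auto
    then show ?thesis by eventually_elim (use True in simp)
  next
    case False
    have "\<forall>\<^sub>F x in nhds \<alpha>. x \<in> {..<0}" using False assms by (intro eventually_nhds_in_open) auto
    then show ?thesis by eventually_elim (use False assms in simp)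
  qed
  show ?thesis
    using S sg eventually_in_newton_domain[OF C2 \<open>deriv f \<alpha> \<noteq> 0\<close>]
  proof eventually_elim
    case (elim x)
    have "real_power_defined x q" using elim assms by (blast intro: real_power_defined_same_sign)
    then show ?case
      using elim assms binomial_newton_power_in_range binomial_newton_map_eq
      by (simp add: binomial_newton_domain_def)
  qed
qed

text \<open>The closed form is the Newton step plus \<open>(h x)\<^sup>2 * K (h x / x) / x\<close>.
  After division by \<open>(x - \<alpha>)\<^sup>2\<close> the extra term tends to
  \<open>K 0 / \<alpha>\<close>, since \<open>h x / (x - \<alpha>)\<close> tends to -1.\<close>

lemma binomial_newton_quadratic_error:
  assumes C2: "C2_near f \<alpha>" and \<alpha>: "\<alpha> \<noteq> 0" and f: "f \<alpha> = 0" "deriv f \<alpha> \<noteq> 0"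
    and q: "q \<noteq> 0" "real_power_defined \<alpha> q" and N: "N \<ge> 1"
  shows "((\<lambda>x. (binomial_newton_map f q N \<alpha> x - \<alpha>) / (x - \<alpha>)\<^sup>2) \<longlongrightarrow>
           deriv (deriv f) \<alpha> / (2 * deriv f \<alpha>) + (if N = 1 then (1 - q) / 2 else 0) / \<alpha>) (at \<alpha>)"
proof -
  define c where "c = (if N = 1 then (1 - q) / 2 else 0)"
  define K where
    "K t = (if t = 0 then c else (truncated_binomial q N t powr (1 / q) - 1 - t) / t\<^sup>2)" for t
  \<comment> \<open>At \<open>t = 0\<close> both sides are 1, so a vanishing correction needs no
    separate case.\<close>
  have K: "truncated_binomial q N t powr (1 / q) = 1 + t + t\<^sup>2 * K t" for t
    by (simp add: K_def truncated_binomial_def sum.atMost_shift)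
  have K_cont: "isCont K 0"
    unfolding K_def c_def
    by (rule isCont_fill_in[OF truncated_binomial_powr_second_order[OF q(1) N]])
  define h where "h x = newton_map f x - x" for x
  have h: "((\<lambda>x. h x / (x - \<alpha>)) \<longlongrightarrow> -1) (at \<alpha>)"
    unfolding h_def using newton_correction_tendsto[OF C2 f] .
  then have "((\<lambda>x. h x / (x - \<alpha>) * (x - \<alpha>) / x) \<longlongrightarrow> -1 * (\<alpha> - \<alpha>) / \<alpha>) (at \<alpha>)"
    by (intro tendsto_intros \<alpha>)
  then have "((\<lambda>x. h x / (x - \<alpha>) * (x - \<alpha>) / x) \<longlongrightarrow> 0) (at \<alpha>)" by simp
  then have "((\<lambda>x. h x / x) \<longlongrightarrow> 0) (at \<alpha>)"
    by (rule Lim_transform_eventually)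
      (use eventually_neq_at_within[of \<alpha>] in eventually_elim, simp)
  then have "((\<lambda>x. K (h x / x)) \<longlongrightarrow> K 0) (at \<alpha>)"
    by (rule isCont_tendsto_compose[OF K_cont])
  then have "((\<lambda>x. (newton_map f x - \<alpha>) / (x - \<alpha>)\<^sup>2 + (h x / (x - \<alpha>))\<^sup>2 * K (h x / x) / x) \<longlongrightarrow>
      deriv (deriv f) \<alpha> / (2 * deriv f \<alpha>) + (-1)\<^sup>2 * K 0 / \<alpha>) (at \<alpha>)"
    by (intro tendsto_intros newton_quadratic_error C2 f h \<alpha>)
  moreover have "\<forall>\<^sub>F x in at \<alpha>. binomial_newton_map f q N \<alpha> x =
      x * truncated_binomial q N (h x / x) powr (1 / q)"
    using eventually_binomial_newton[OF C2 \<alpha> f q, of N]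
    unfolding h_def eventually_at_filter by eventually_elim simp
  moreover have "\<forall>\<^sub>F x in at \<alpha>. x \<noteq> 0"
    using \<alpha> by (intro tendsto_imp_eventually_ne[OF tendsto_ident_at])
  ultimately have "((\<lambda>x. (binomial_newton_map f q N \<alpha> x - \<alpha>) / (x - \<alpha>)\<^sup>2) \<longlongrightarrow>
      deriv (deriv f) \<alpha> / (2 * deriv f \<alpha>) + (-1)\<^sup>2 * K 0 / \<alpha>) (at \<alpha>)"
  proof (elim Lim_transform_eventually, goal_cases)
    case 1
    then show ?case
    proof eventually_elim
      case (elim x)
      \<comment> \<open>Expanding \<open>x * (1 + t + t\<^sup>2 * K t)\<close> at
        \<open>t = h x / x\<close> gives \<open>x + h x\<close>, the Newton step, and the extra
        term.\<close>
      have "binomial_newton_map f q N \<alpha> x = newton_map f x + (h x)\<^sup>2 * K (h x / x) / x"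
        using elim(2) unfolding elim(1) K
        by (simp add: h_def field_simps power2_eq_square)
      then show ?case by (simp add: power_divide add_divide_distrib diff_divide_distrib)
    qed
  qed
  then show ?thesis by (simp add: K_def c_def)
qed

section \<open>Comparison of the two error constants\<close>

theorem theorem4p1:
  fixes f :: "real \<Rightarrow> real" and \<alpha> q :: real and N :: nat
  assumes "C2_near f \<alpha>"
    and "\<alpha> \<noteq> 0"
    and "f \<alpha> = 0"
    and "deriv f \<alpha> \<noteq> 0"
    and "deriv (deriv f) \<alpha> \<noteq> 0"
    and "q \<noteq> 0"
    and "real_power_defined \<alpha> q"
    and "N \<ge> 1"
  shows "(\<bar>1 + deriv f \<alpha> / deriv (deriv f) \<alpha> * ((1 - q) / \<alpha>)\<bar> \<le> 1 \<longleftrightarrow>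
          0 \<le> deriv f \<alpha> / deriv (deriv f) \<alpha> * ((q - 1) / \<alpha>) \<and>
          deriv f \<alpha> / deriv (deriv f) \<alpha> * ((q - 1) / \<alpha>) \<le> 2) \<and>
         (\<bar>1 + deriv f \<alpha> / deriv (deriv f) \<alpha> * ((1 - q) / \<alpha>)\<bar> \<le> 1 \<longrightarrow>
          equal_or_faster
            (binomial_newton_domain f q N \<alpha>) (binomial_newton_map f q N \<alpha>)
            (newton_domain f) (newton_map f) \<alpha>)"
proof (intro conjI impI)
  let ?\<kappa> = "deriv f \<alpha> / deriv (deriv f) \<alpha>"
  \<comment> \<open>With \<open>s\<close> for the product containing \<open>q - 1\<close>, the
    equivalence is that of \<open>\<bar>1 - s\<bar> \<le> 1\<close> with \<open>0 \<le> s\<close>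
    and \<open>s \<le> 2\<close>.\<close>
  have "?\<kappa> * ((1 - q) / \<alpha>) = - (?\<kappa> * ((q - 1) / \<alpha>))"
    by (metis minus_diff_eq minus_divide_left mult_minus_right)
  then show "\<bar>1 + ?\<kappa> * ((1 - q) / \<alpha>)\<bar> \<le> 1 \<longleftrightarrow>
      0 \<le> ?\<kappa> * ((q - 1) / \<alpha>) \<and> ?\<kappa> * ((q - 1) / \<alpha>) \<le> 2"
    by linarith
  assume le: "\<bar>1 + ?\<kappa> * ((1 - q) / \<alpha>)\<bar> \<le> 1"
  let ?B = "deriv (deriv f) \<alpha> / (2 * deriv f \<alpha>)"
  let ?A = "?B + (if N = 1 then (1 - q) / 2 else 0) / \<alpha>"
  have lim: "((\<lambda>x. (binomial_newton_map f q N \<alpha> x - \<alpha>) / (x - \<alpha>)\<^sup>2) \<longlongrightarrow> ?A) (at \<alpha>)"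
      "((\<lambda>x. (newton_map f x - \<alpha>) / (x - \<alpha>)\<^sup>2) \<longlongrightarrow> ?B) (at \<alpha>)"
    using assms binomial_newton_quadratic_error newton_quadratic_error by blast+
  have ev: "\<forall>\<^sub>F x in nhds \<alpha>. x \<in> binomial_newton_domain f q N \<alpha> \<and>
      binomial_newton_map f q N \<alpha> x =
        x * truncated_binomial q N ((newton_map f x - x) / x) powr (1 / q)"
    using assms eventually_binomial_newton by blast
  have "binomial_newton_map f q N \<alpha> \<alpha> = \<alpha>"
    using eventually_nhds_x_imp_x[OF ev] assms(3)
    by (simp add: newton_map_def truncated_binomial_def sum.atMost_shift)
  moreover have "\<forall>\<^sub>F x in nhds \<alpha>. x \<in> binomial_newton_domain f q N \<alpha>"
    using ev by eventually_elim simp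
  ultimately have A: "converges_locally (binomial_newton_domain f q N \<alpha>) (binomial_newton_map f q N \<alpha>) \<alpha>"
    using lim(1) by (intro converges_locally_if_quadratic)
  have B: "converges_locally (newton_domain f) (newton_map f) \<alpha>"
    using lim(2) assms
    by (intro converges_locally_if_quadratic eventually_in_newton_domain) (auto simp: newton_map_def)
  have "\<bar>?A\<bar> \<le> \<bar>?B\<bar>"
  proof (cases "N = 1")
    case True
    \<comment> \<open>Here \<open>?B * ?\<kappa> = 1 / 2\<close>, so factoring out \<open>?B\<close>
      turns the added \<open>(1 - q) / 2 / \<alpha>\<close> into the term of the hypothesis.\<close>
    then have "?A = ?B * (1 + ?\<kappa> * ((1 - q) / \<alpha>))"
      using assms by (simp add: field_simps)
    then have "\<bar>?A\<bar> = \<bar>?B\<bar> * \<bar>1 + ?\<kappa> * ((1 - q) / \<alpha>)\<bar>" by (simp only: abs_mult)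
    also have "\<dots> \<le> \<bar>?B\<bar> * 1" using le by (intro mult_left_mono) auto
    finally show ?thesis by simp
  qed simp
  with A B lim show "equal_or_faster (binomial_newton_domain f q N \<alpha>) (binomial_newton_map f q N \<alpha>)
      (newton_domain f) (newton_map f) \<alpha>"
    unfolding equal_or_faster_def by (blast intro: has_asymptotic_error_constantI)
qed

end
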